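(* Let $\mathcal D=[0,1]^2$ be partitioned into disjoint sub-domains $\mathcal D_{1,0},\dots,\mathcal D_{k_0,0}$ (which, together with $k_0$, may vary with $n$), and suppose there are constants $c',C'>0$ such that for all $1\le l\le k_0$: $c'k_0^{-1}\le|\mathcal D_{l,0}|\le C'k_0^{-1}$; $c'\le|\partial\mathcal D_{l,0}|/|\mathcal D_{l,0}|^{1/2}\le C'$; $N(\partial\mathcal D_{l,0},\delta,\|\cdot\|_2)\le C'|\partial\mathcal D_{l,0}|\delta^{-1}$ for all $0<\delta<|\partial\mathcal D_{l,0}|$; and for any $\boldsymbol s,\boldsymbol s'\in\mathcal D_{l,0}$ there is a path $\mathcal P(\boldsymbol s,\boldsymbol s')$ contained in $\mathcal D_{l,0}$ connecting $\boldsymbol s$ and $\boldsymbol s'$ with $d\{\mathcal P(\boldsymbol s,\boldsymbol s'),\partial\mathcal D_{l,0}\}=\min\{d(\boldsymbol s,\partial\mathcal D_{l,0}),d(\boldsymbol s',\partial\mathcal D_{l,0})\}$ or $d\{\mathcal P(\boldsymbol s,\boldsymbol s'),\partial\mathcal D_{l,0}\}\ge C'$. Then there exists a contiguous domain partition $\pi_0^*(\mathcal D)=\{\mathcal D_{1,0}^*,\dots,\mathcal D_{k_0,0}^*\}$ in the partition model space (defined in the context) such that $$|\mathcal W_{\pi_0^*}|=\sum_{j=1}^{k_0}\big|\{B_m:B_m\subseteq\mathcal D_{j,0}^*,\ B_m\not\subseteq\mathcal D_{j,0}\}\big|\le c\,k_0^{1/2}K$$ for some constant $c$, where $\mathcal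 W_{\pi_0^*}=\bigcup_{j=1}^{k_0}\{B_m:B_m\subseteq\mathcal D_{j,0}^*,\ B_m\not\subseteq\mathcal D_{j,0}\}$ is the set of blocks that are inside some $\mathcal D_{j,0}^*$ but not fully included in the corresponding $\mathcal D_{j,0}$.
   Context: $K$ is a positive integer (a model hyperparameter, which may vary with the sample size $n$). $\mathcal D$ is split into $K^2$ disjoint square blocks $B_1,\dots,B_{K^2}$ of side length $K^{-1}$; $\mathcal G=(\mathcal V,\mathcal E)$ is the $K\times K$ mesh grid graph whose vertices are the blocks and whose edges connect adjacent blocks. The partition model space consists of the domain partitions obtained as follows: take a spanning tree of $\mathcal G$, delete some of its edges, let the resulting connected components partition the blocks into clusters (each cluster is then connected in $\mathcal G$, i.e. contiguous), and give all points of a block the cluster of that block. $|\cdot|$ is area for planar regions and cardinality for finite sets; $d(\cdot,\cdot)$ is Euclidean distance between points and infimum distance between sets; $N(\cdot,\delta,\|\cdot\|_2)$ is the $\delta$-covering number; $|\partial\mathcal D_{l,0}|=\lim_{\delta\to0}\delta N(\partial\mathcal D_{l,0},\delta,\|\cdot\|_2)$ is the length of the boundary $\partial\mathcal D_{l,0}$. Constants do not vary with $n$.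
   Formalization: The formal statement adds the assumption k_0 ≤ K^2 for every n; without it the claim fails (K=1, k_0=4, quarter squares), since a partition in the model space has at most K^2 clusters. *)

theory Defs
  imports "HOL-Analysis.Analysis"
begin

text \<open>
  Closed balls with centres anywhere in the space. The value is meaningful only for totally
  bounded \<open>S\<close> and \<open>\<delta> > 0\<close>, where a finite cover exists; for other arguments
  \<open>LEAST\<close> yields an unspecified number.
\<close>

definition covering_number :: "'a::metric_space set \<Rightarrow> real \<Rightarrow> nat" where
  "covering_number S \<delta> = (LEAST N. \<exists>C. finite C \<and> card C = N \<and> S \<subseteq> (\<Union>x\<in>C. cball x \<delta>))"

text \<open>
  \<open>Lim\<close> is unspecified when the limit does not exist, so existence of the limit has to be
  required separately: \<open>has_boundary_length\<close>. The boundary is the topological boundary in the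
  plane; for a subset of the unit square it may include parts of the sides of the square. With balls of radius
  \<open>\<delta>\<close> the limit for a rectifiable curve is half of its arc length.
\<close>

definition boundary_length :: "(real \<times> real) set \<Rightarrow> real" where
  "boundary_length S = Lim (at_right 0) (\<lambda>\<delta>. \<delta> * real (covering_number (frontier S) \<delta>))"

definition has_boundary_length :: "(real \<times> real) set \<Rightarrow> bool" where
  "has_boundary_length S \<longleftrightarrow>
     (\<exists>L. ((\<lambda>\<delta>. \<delta> * real (covering_number (frontier S) \<delta>)) \<longlongrightarrow> L) (at_right 0))"

text \<open>Undirected graphs are pairs of a vertex set and a set of two-element edges.\<close>

definition reach :: "'a set set \<Rightarrow> 'a \<Rightarrow> 'a \<Rightarrow> bool" where
  "reach E = (\<lambda>x y. {x, y} \<in> E)\<^sup>*\<^sup>*"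

definition connected_graph :: "'a set \<Rightarrow> 'a set set \<Rightarrow> bool" where
  "connected_graph V E \<longleftrightarrow> V \<noteq> {} \<and> (\<forall>u\<in>V. \<forall>v\<in>V. reach E u v)"

definition is_cycle :: "'a set set \<Rightarrow> 'a list \<Rightarrow> bool" where
  "is_cycle E c \<longleftrightarrow> length c \<ge> 3 \<and> distinct c \<and>
     (\<forall>i<length c. {c ! i, c ! (Suc i mod length c)} \<in> E)"

definition is_spanning_tree :: "'a set \<Rightarrow> 'a set set \<Rightarrow> 'a set set \<Rightarrow> bool" where
  "is_spanning_tree V E T \<longleftrightarrow> T \<subseteq> E \<and> connected_graph V T \<and> \<not> (\<exists>c. is_cycle T c)"

definition graph_components :: "'a set \<Rightarrow> 'a set set \<Rightarrow> 'a set set" where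
  "graph_components V E = (\<lambda>u. {v \<in> V. reach E u v}) ` V"

text \<open>
  The intervals are half-open, except that the last one contains its right endpoint, so that the
  blocks are pairwise disjoint and cover the whole closed unit square.
\<close>

definition cell :: "nat \<Rightarrow> nat \<Rightarrow> real set" where
  "cell K i = (if Suc i = K then {real i / real K..1}
               else {real i / real K..<real (Suc i) / real K})"

definition block :: "nat \<Rightarrow> nat \<Rightarrow> nat \<Rightarrow> (real \<times> real) set" where
  "block K i j = cell K i \<times> cell K j"

definition blocks :: "nat \<Rightarrow> (real \<times> real) set set" where
  "blocks K = {block K i j | i j. i < K \<and> j < K}"

definition grid_edges :: "nat \<Rightarrow> (real \<times> real) set set set" where
  "grid_edges K = {{block K i j, block K i' j'} | i j i' j'.
     i < K \<and> j < K \<and> i' < K \<and> j' < K \<and> \<bar>int i - int i'\<bar> + \<bar>int j - int j'\<bar> = 1}"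

text \<open>
  \<open>F\<close> is the set of edges deleted from the spanning tree \<open>T\<close>. A cluster is a component, hence a
  set of blocks; the corresponding sub-domain is the union of these blocks.
\<close>

definition model_space :: "nat \<Rightarrow> (real \<times> real) set set set" where
  "model_space K = {\<Union> ` graph_components (blocks K) (T - F) | T F.
     is_spanning_tree (blocks K) (grid_edges K) T \<and> F \<subseteq> T}"

definition misplaced :: "nat \<Rightarrow> (real \<times> real) set \<Rightarrow> (real \<times> real) set \<Rightarrow> (real \<times> real) set set" where
  "misplaced K Dstar D = {B \<in> blocks K. B \<subseteq> Dstar \<and> \<not> B \<subseteq> D}"

end

theory Submission
  imports Defs
begin

text \<open>
  If \<open>K\<close> is at most a constant times \<open>sqrt k0\<close>, any contiguous partition into \<open>k0\<close> clusters
  will do, since there are only \<open>K\<^sup>2\<close> blocks. Otherwise call a point of \<open>D l\<close> deep if its distance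
  from the frontier of \<open>D l\<close> is at least \<open>3 / K\<close>. Covering the frontier by balls of radius \<open>1 / K\<close>
  shows that few blocks contain shallow points, so by the lower bound on the area deep points exist.
  The path between two deep points stays deep, so the blocks that contain deep points of \<open>D l\<close> lie in
  a single grid component of the blocks included in \<open>D l\<close>. These components are disjoint seeds;
  since the grid is connected they grow to a partition into connected clusters, and only blocks
  outside the seeds, which lie near some frontier, can be misplaced.
\<close>

section \<open>Spanning trees and connected partitions\<close>

lemma reach_refl [simp]: "reach E x x"
  by (simp add: reach_def)

lemma reach_edge: "{x, y} \<in> E \<Longrightarrow> reach E x y"
  by (auto simp: reach_def)

lemma reach_trans: "reach E x y \<Longrightarrow> reach E y z \<Longrightarrow> reach E x z"
  by (auto simp: reach_def)

lemma reach_sym: "reach E x y \<Longrightarrow> reach E y x"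
  unfolding reach_def
proof (induction rule: rtranclp_induct)
  case (step y z)
  then have "{z, y} \<in> E" by (simp add: insert_commute)
  with step.IH show ?case by (intro converse_rtranclp_into_rtranclp[of _ z y])
qed simp

lemma reach_subst:
  assumes "\<And>u v. {u, v} \<in> E \<Longrightarrow> reach T u v" "reach E x y"
  shows "reach T x y"
  using assms(2) unfolding reach_def[of E]
proof (induction rule: rtranclp_induct)
  case (step y z)
  from step.hyps(2) have "reach T y z" by (rule assms(1))
  with step.IH show ?case by (rule reach_trans)
qed simp

lemma reach_mono: "reach E x y \<Longrightarrow> E \<subseteq> E' \<Longrightarrow> reach E' x y"
  by (rule reach_subst[of E]) (auto intro: reach_edge)

lemma reach_closed:
  assumes "reach E x y" "x \<in> S" "\<And>u v. {u, v} \<in> E \<Longrightarrow> u \<in> S \<Longrightarrow> v \<in> S"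
  shows "y \<in> S"
  using assms(1) unfolding reach_def
proof (induction rule: rtranclp_induct)
  case base
  show ?case by (rule assms(2))
next
  case (step y z)
  show ?case by (rule assms(3)[OF step.hyps(2) step.IH])
qed

lemma reach_within_component:
  assumes "reach E x y"
  shows "reach {e \<in> E. e \<subseteq> {z. reach E x z}} x y"
  using assms unfolding reach_def[of E]
proof (induction rule: rtranclp_induct)
  case (step y z)
  then have "reach E x y" and e: "{y, z} \<in> E"
    by (simp_all add: reach_def)
  have "reach E x z"
    by (rule reach_trans[OF \<open>reach E x y\<close> reach_edge[OF e]])
  with \<open>reach E x y\<close> e have "reach {e \<in> E. e \<subseteq> {z. reach E x z}} y z"
    by (intro reach_edge) auto
  from step.IH this[unfolded reach_def[of E]] show ?case by (rule reach_trans)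
qed simp

text \<open>A cycle that was not there before must use the added edge; going round the rest of it
  joins the two ends of that edge by old edges.\<close>

lemma new_cycle_imp_reach:
  assumes cyc: "is_cycle (insert {u, v} T) c" and ncyc: "\<not> is_cycle T c"
  shows "reach T u v"
proof -
  define n where "n = length c"
  define nx where "nx j = Suc j mod n" for j
  have n: "n \<ge> 3" and dist: "distinct c"
    and ed: "\<And>i. i < n \<Longrightarrow> {c ! i, c ! nx i} \<in> insert {u, v} T"
    using cyc by (auto simp: is_cycle_def n_def nx_def)
  obtain i where i: "i < n" "{c ! i, c ! nx i} \<notin> T"
    using ncyc n dist by (auto simp: is_cycle_def n_def nx_def)
  then have uv: "{c ! i, c ! nx i} = {u, v}"
    using ed by blast
  have nx: "nx j < n" for j
    using n by (simp add: nx_def)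
  have nx': "nx j = (if Suc j = n then 0 else Suc j)" if "j < n" for j
    using that by (simp add: nx_def)
  \<comment> \<open>The added edge occurs at position \<open>i\<close> only: a second occurrence
    would run through the same two vertices in the opposite order, so \<open>nx (nx i) = i\<close>,
    which a cycle of length at least 3 excludes.\<close>
  have edT: "{c ! j, c ! nx j} \<in> T" if "j < n" "j \<noteq> i" for j
  proof (rule ccontr)
    assume "{c ! j, c ! nx j} \<notin> T"
    then have "{c ! j, c ! nx j} = {c ! i, c ! nx i}"
      using ed[OF that(1)] uv by simp
    then have "c ! j = c ! nx i \<and> c ! nx j = c ! i"
      using that i nth_eq_iff_index_eq[OF dist, of j i] unfolding doubleton_eq_iff n_def by metis
    then have "j = nx i" "nx j = i"
      using nth_eq_iff_index_eq[OF dist] that(1) i(1) nx[of i] nx[of j] unfolding n_def by metis+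
    then have "nx (nx i) = i" by metis
    then show False
      using n i(1) nx'[OF i(1)] nx'[OF nx[of i]] by (cases "Suc i = n") (auto split: if_splits)
  qed
  \<comment> \<open>Start just after the added edge and go round. Position \<open>i\<close> is
    reached only at \<open>k = n - 1\<close>, so every edge traversed on the way lies in
    \<open>T\<close>.\<close>
  have *: "reach T (c ! nx i) (c ! ((Suc i + k) mod n))" if "k < n" for k
    using that
  proof (induction k)
    case 0
    then show ?case by (simp add: nx_def)
  next
    case (Suc k)
    let ?j = "(Suc i + k) mod n"
    have ne: "?j \<noteq> i"
    proof
      assume "?j = i"
      then have "(i + Suc k) mod n = (i + 0) mod n"
        using i by simp
      then have "n dvd Suc k"
        using mod_eq_dvd_iff_nat[of i "i + Suc k" n] by simp
      then show False
        using Suc.prems by (auto dest: dvd_imp_le)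
    qed
    have "nx ?j = (Suc i + Suc k) mod n"
      unfolding nx_def by (simp add: mod_Suc_eq)
    then have "{c ! ?j, c ! ((Suc i + Suc k) mod n)} \<in> T"
      using edT[of ?j] ne n by simp
    then have "reach T (c ! ?j) (c ! ((Suc i + Suc k) mod n))"
      by (rule reach_edge)
    then show ?case
      using reach_trans[OF Suc.IH[OF Suc_lessD[OF Suc.prems]]] by metis
  qed
  have "reach T (c ! nx i) (c ! i)"
    using *[of "n - 1"] n i by simp
  then show ?thesis
    using uv reach_sym[of T u v] reach_sym[of T v u] unfolding doubleton_eq_iff by metis
qed

lemma not_is_cycle_empty: "\<not> is_cycle {} c"
  by (cases c) (auto simp: is_cycle_def)

text \<open>Take a maximal acyclic set between \<open>A\<close> and \<open>E\<close>: an edge that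
  cannot be added would close a cycle, so its ends are already joined. The conclusion compares
  \<open>reach\<close> relations because it is also applied to a disconnected edge set.\<close>

lemma acyclic_extension:
  assumes "finite E" "A \<subseteq> E" "\<not> (\<exists>c. is_cycle A c)"
  obtains T where "A \<subseteq> T" "T \<subseteq> E" "\<not> (\<exists>c. is_cycle T c)" "reach T = reach E"
proof -
  let ?S = "{T. A \<subseteq> T \<and> T \<subseteq> E \<and> \<not> (\<exists>c. is_cycle T c)}"
  have "finite ?S"
    by (rule finite_subset[of _ "Pow E"]) (use assms in auto)
  moreover have "A \<in> ?S" using assms by auto
  ultimately obtain T where T: "T \<in> ?S" and max: "\<And>T'. T' \<in> ?S \<Longrightarrow> T \<subseteq> T' \<Longrightarrow> T = T'"
    by (metis (no_types, lifting) empty_iff finite_has_maximal)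
  have edge: "reach T u v" if uv: "{u, v} \<in> E" for u v
  proof (cases "{u, v} \<in> T")
    case False
    then have "insert {u, v} T \<notin> ?S"
      using max[of "insert {u, v} T"] by blast
    then obtain c where c: "is_cycle (insert {u, v} T) c"
      using T uv by auto
    then show ?thesis
      using T new_cycle_imp_reach[OF c] by auto
  qed (rule reach_edge)
  have "reach T = reach E"
    using T by (intro ext iffI) (blast intro: reach_mono, rule reach_subst[OF edge])
  with T show ?thesis
    by (intro that[of T]) auto
qed

text \<open>Connectedness of the induced subgraph: walks may not leave \<open>S\<close>. In contrast
  to \<open>connected_graph\<close>, the empty set qualifies.\<close>

definition connected_in :: "'a set set \<Rightarrow> 'a set \<Rightarrow> bool" where
  "connected_in E S \<longleftrightarrow> (\<forall>u\<in>S. \<forall>v\<in>S. reach {e \<in> E. e \<subseteq> S} u v)"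

lemma connected_inD: "connected_in E S \<Longrightarrow> u \<in> S \<Longrightarrow> v \<in> S \<Longrightarrow> reach {e \<in> E. e \<subseteq> S} u v"
  by (auto simp: connected_in_def)

lemma connected_in_star:
  assumes "\<And>v. v \<in> S \<Longrightarrow> reach {e \<in> E. e \<subseteq> S} u v"
  shows "connected_in E S"
  unfolding connected_in_def using assms by (meson reach_sym reach_trans)

lemma connected_in_mono: "connected_in E S \<Longrightarrow> E \<subseteq> E' \<Longrightarrow> connected_in E' S"
  unfolding connected_in_def
proof (intro ballI)
  fix u v assume uv: "\<forall>u\<in>S. \<forall>v\<in>S. reach {e \<in> E. e \<subseteq> S} u v" "E \<subseteq> E'" "u \<in> S" "v \<in> S"
  then have "reach {e \<in> E. e \<subseteq> S} u v" by simp
  then show "reach {e \<in> E'. e \<subseteq> S} u v" by (rule reach_mono) (use uv(2) in blast)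
qed

lemma connected_in_component: "connected_in E {z. reach E x z}"
  by (rule connected_in_star[where u = x]) (auto intro: reach_within_component)

lemma connected_in_insert:
  assumes "connected_in E S" "u \<in> S" "{u, w} \<in> E"
  shows "connected_in E (insert w S)"
proof (rule connected_in_star[where u = u])
  fix v assume v: "v \<in> insert w S"
  show "reach {e \<in> E. e \<subseteq> insert w S} u v"
  proof (cases "v = w")
    case True
    then show ?thesis using assms by (intro reach_edge) auto
  next
    case False
    then have "reach {e \<in> E. e \<subseteq> S} u v"
      using v assms by (auto intro: connected_inD)
    then show ?thesis by (rule reach_mono) auto
  qed
qed

text \<open>The seeds grow by one vertex at a time, by induction on the number of uncovered
  vertices. Attaching a vertex along an edge keeps its part connected.\<close>

lemma connected_partition_extension:
  assumes "finite V" "connected_graph V E" "\<And>e. e \<in> E \<Longrightarrow> e \<subseteq> V" "I \<noteq> {}"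
    and "\<And>i. i \<in> I \<Longrightarrow> H i \<noteq> {} \<and> H i \<subseteq> V \<and> connected_in E (H i)"
    and "disjoint_family_on H I"
  shows "\<exists>P. (\<forall>i\<in>I. H i \<subseteq> P i \<and> connected_in E (P i)) \<and> disjoint_family_on P I \<and> (\<Union>i\<in>I. P i) = V"
  using assms(5,6)
proof (induction "card (V - (\<Union>i\<in>I. H i))" arbitrary: H rule: less_induct)
  case less
  let ?U = "\<Union>i\<in>I. H i"
  show ?case
  proof (cases "?U = V")
    case True
    with less.prems show ?thesis by (intro exI[of _ H] conjI ballI) simp_all
  next
    case False
    moreover have "?U \<subseteq> V" using less.prems(1) by (simp add: UN_least)
    ultimately obtain w where w: "w \<in> V" "w \<notin> ?U" by blast
    obtain i0 where i0: "i0 \<in> I" using assms(4) by blast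
    then obtain x where x: "x \<in> H i0" "x \<in> V" using less.prems(1)[OF i0] by blast
    have "reach E x w" using assms(2) w x by (auto simp: connected_graph_def)
    moreover have "x \<in> ?U" using i0 x by blast
    \<comment> \<open>If no edge left the covered set, it would be closed under walks and would
      contain \<open>w\<close>.\<close>
    ultimately obtain u v where uv: "{u, v} \<in> E" "u \<in> ?U" "v \<notin> ?U"
      using reach_closed[of E x w ?U] w by metis
    then obtain j where j: "j \<in> I" "u \<in> H j" by auto
    have v: "v \<in> V" using assms(3)[OF uv(1)] by auto
    define H' where "H' = H(j := insert v (H j))"
    have U': "(\<Union>i\<in>I. H' i) = insert v ?U"
      using j by (auto simp: H'_def split: if_splits)
    have "card (V - (\<Union>i\<in>I. H' i)) < card (V - ?U)"
      unfolding U' by (rule psubset_card_mono) (use assms(1) v uv in auto)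
    moreover have "H' i \<noteq> {} \<and> H' i \<subseteq> V \<and> connected_in E (H' i)" if "i \<in> I" for i
      using less.prems(1)[OF that] v uv j by (auto simp: H'_def intro: connected_in_insert)
    moreover have "disjoint_family_on H' I"
      using less.prems(2) uv unfolding disjoint_family_on_def H'_def by auto
    ultimately obtain P where P: "\<forall>i\<in>I. H' i \<subseteq> P i \<and> connected_in E (P i)"
        "disjoint_family_on P I" "(\<Union>i\<in>I. P i) = V"
      using less.hyps[of H'] by metis
    have "H i \<subseteq> P i" if "i \<in> I" for i
      using P(1) that by (auto simp: H'_def split: if_splits)
    with P show ?thesis by (intro exI[of _ P]) auto
  qed
qed

text \<open>
  The spanning tree is a maximal acyclic extension of a maximal acyclic set of edges inside the
  parts, so deleting the edges between parts leaves exactly the parts as components.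
\<close>
lemma spanning_tree_of_connected_partition:
  assumes "finite E" "connected_graph V E"
    and con: "\<And>i. i \<in> I \<Longrightarrow> connected_in E (P i)" and ne: "\<And>i. i \<in> I \<Longrightarrow> P i \<noteq> {}"
    and disj: "disjoint_family_on P I" and V: "(\<Union>i\<in>I. P i) = V"
  shows "\<exists>T F. is_spanning_tree V E T \<and> F \<subseteq> T \<and> graph_components V (T - F) = P ` I"
proof -
  define E0 where "E0 = {e \<in> E. \<exists>i\<in>I. e \<subseteq> P i}"
  have E0: "E0 \<subseteq> E" "finite E0" using assms(1) by (auto simp: E0_def)
  obtain T0 where T0: "T0 \<subseteq> E0" "\<not> (\<exists>c. is_cycle T0 c)" "reach T0 = reach E0"
    by (rule acyclic_extension[OF E0(2) empty_subsetI]) (auto simp: not_is_cycle_empty)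
  obtain T where T: "T0 \<subseteq> T" "T \<subseteq> E" "\<not> (\<exists>c. is_cycle T c)" "reach T = reach E"
    by (rule acyclic_extension[OF assms(1) order_trans[OF T0(1) E0(1)] T0(2)])
  \<comment> \<open>Each part is connected by its own edges, all of which are in \<open>E0\<close>.
    Conversely an edge of \<open>E0\<close> lies inside one part, and by disjointness this is the
    part of either end, so no walk leaves a part.\<close>
  have comp: "{v \<in> V. reach E0 u v} = P i" if i: "i \<in> I" "u \<in> P i" for i u
  proof
    show "P i \<subseteq> {v \<in> V. reach E0 u v}"
    proof
      fix v assume v: "v \<in> P i"
      have "reach {e \<in> E. e \<subseteq> P i} u v"
        using con i v by (auto intro: connected_inD)
      then have "reach E0 u v" by (rule reach_mono) (use i in \<open>auto simp: E0_def\<close>)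
      then show "v \<in> {v \<in> V. reach E0 u v}" using V i v by auto
    qed
    have "b \<in> P i" if ab: "{a, b} \<in> E0" "a \<in> P i" for a b
    proof -
      obtain j where j: "j \<in> I" "{a, b} \<subseteq> P j" using ab by (auto simp: E0_def)
      then have "j = i" using disj i ab by (auto simp: disjoint_family_on_def)
      with j show ?thesis by auto
    qed
    then show "{v \<in> V. reach E0 u v} \<subseteq> P i"
      using i reach_closed[of E0 _ _ "P i"] by auto
  qed
  have "graph_components V T0 = P ` I"
    unfolding graph_components_def T0(3)
  proof (intro equalityI subsetI)
    fix X assume "X \<in> (\<lambda>u. {v \<in> V. reach E0 u v}) ` V"
    then obtain u where "u \<in> V" "X = {v \<in> V. reach E0 u v}" by auto
    with comp V show "X \<in> P ` I" by blast
  next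
    fix X assume "X \<in> P ` I"
    then obtain i where i: "i \<in> I" "X = P i" by auto
    with ne obtain u where "u \<in> P i" by blast
    then show "X \<in> (\<lambda>u. {v \<in> V. reach E0 u v}) ` V"
      using comp[OF i(1)] i V by (intro image_eqI[of _ _ u]) auto
  qed
  moreover have "is_spanning_tree V E T"
    using T assms(2) by (simp add: is_spanning_tree_def connected_graph_def)
  moreover have "T - (T - T0) = T0" using T by auto
  ultimately show ?thesis
    by (intro exI[of _ T] exI[of _ "T - T0"]) auto
qed

section \<open>Blocks and the grid graph\<close>

text \<open>The minimum assigns the point 1 to the last cell, in agreement with the closed right end
  in \<open>cell\<close>.\<close>

definition cell_index :: "nat \<Rightarrow> real \<Rightarrow> nat" where
  "cell_index K x = min (K - 1) (nat \<lfloor>x * real K\<rfloor>)"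

definition block_of :: "nat \<Rightarrow> real \<times> real \<Rightarrow> (real \<times> real) set" where
  "block_of K s = block K (cell_index K (fst s)) (cell_index K (snd s))"

lemma cell_index_less: "K > 0 \<Longrightarrow> cell_index K x < K"
  by (auto simp: cell_index_def)

text \<open>After scaling by \<open>K\<close>, membership compares a floor with integers. Outside
  the unit interval \<open>cell_index\<close> still returns 0 or \<open>K - 1\<close> although no
  cell contains the point, hence the bounds on \<open>x\<close>.\<close>

lemma mem_cell_iff:
  assumes "i < K" "0 \<le> x" "x \<le> 1"
  shows "x \<in> cell K i \<longleftrightarrow> cell_index K x = i"
proof -
  have K: "real K > 0" using assms(1) by simp
  have "0 \<le> x * real K" using assms by simp
  then have fl: "real m \<le> x * real K \<longleftrightarrow> m \<le> nat \<lfloor>x * real K\<rfloor>" for m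
    by (simp add: le_nat_iff le_floor_iff)
  have fl': "x * real K < real m \<longleftrightarrow> nat \<lfloor>x * real K\<rfloor> < m" for m
    using fl[of m] by linarith
  show ?thesis
  proof (cases "Suc i = K")
    case True
    then have "x \<in> cell K i \<longleftrightarrow> real i \<le> x * real K"
      using assms K by (auto simp: cell_def pos_divide_le_eq)
    then show ?thesis
      using True unfolding fl cell_index_def by auto
  next
    case False
    then have "x \<in> cell K i \<longleftrightarrow> real i \<le> x * real K \<and> x * real K < real (Suc i)"
      using K by (auto simp: cell_def pos_divide_le_eq pos_less_divide_eq)
    moreover have "i \<le> N \<and> N < Suc i \<longleftrightarrow> min (K - 1) N = i" for N
      using False assms(1) by (auto simp: min_def)
    ultimately show ?thesis
      unfolding fl fl' cell_index_def by simp
  qed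
qed

lemma cell_bounds:
  assumes "i < K" "x \<in> cell K i"
  shows "real i \<le> x * real K" "x * real K \<le> real i + 1"
proof -
  have K: "real K > 0" using assms(1) by simp
  show "real i \<le> x * real K"
    using assms(2) K by (auto simp: cell_def pos_divide_le_eq split: if_splits)
  show "x * real K \<le> real i + 1"
  proof (cases "Suc i = K")
    case True
    then have "x \<le> 1" using assms(2) by (simp add: cell_def)
    then have "x * real K \<le> real K" using mult_right_mono[of x 1 "real K"] by simp
    also have "real K = real i + 1" using True by auto
    finally show ?thesis .
  next
    case False
    then show ?thesis using assms(2) K by (auto simp: cell_def pos_less_divide_eq)
  qed
qed

lemma cell_subset:
  assumes "i < K"
  shows "cell K i \<subseteq> {0..1}"
proof
  fix x assume x: "x \<in> cell K i"
  have K: "real K > 0" "real i + 1 \<le> real K" using assms by linarith+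
  have "0 \<le> x * real K" "x * real K \<le> 1 * real K"
    using cell_bounds[OF assms x] K by linarith+
  then show "x \<in> {0..1}" using K by (simp add: zero_le_mult_iff)
qed

lemma cell_diameter:
  assumes "i < K" "x \<in> cell K i" "y \<in> cell K i"
  shows "\<bar>x - y\<bar> \<le> 1 / real K"
proof -
  have K: "real K > 0" using assms(1) by simp
  have "\<bar>x * real K - y * real K\<bar> \<le> 1"
    using cell_bounds[OF assms(1,2)] cell_bounds[OF assms(1,3)] by linarith
  then have "\<bar>x - y\<bar> * real K \<le> 1"
    using K by (simp add: left_diff_distrib[symmetric] abs_mult)
  then show ?thesis using K by (simp add: pos_le_divide_eq)
qed

lemma left_end_in_cell: "i < K \<Longrightarrow> real i / real K \<in> cell K i"
  by (auto simp: cell_def divide_simps)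

lemma block_subset:
  assumes "B \<in> blocks K"
  shows "B \<subseteq> {0..1} \<times> {0..1}"
proof -
  obtain i j where ij: "i < K" "j < K" "B = cell K i \<times> cell K j"
    using assms unfolding blocks_def block_def by blast
  show ?thesis
    unfolding ij(3) by (rule Sigma_mono) (use cell_subset ij in blast)+
qed

lemma block_of_in_blocks:
  assumes "K > 0"
  shows "block_of K s \<in> blocks K"
  unfolding blocks_def block_of_def using cell_index_less[OF assms] by blast

lemma mem_block_iff:
  assumes "B \<in> blocks K" "s \<in> {0..1} \<times> {0..1}"
  shows "s \<in> B \<longleftrightarrow> B = block_of K s"
proof -
  obtain i j where ij: "i < K" "j < K" "B = block K i j"
    using assms by (auto simp: blocks_def)
  have *: "s \<in> block K i j \<longleftrightarrow> cell_index K (fst s) = i \<and> cell_index K (snd s) = j"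
    if "i < K" "j < K" for i j
    using assms(2) mem_cell_iff[OF that(1), of "fst s"] mem_cell_iff[OF that(2), of "snd s"]
    by (cases s) (simp add: block_def)
  have "s \<in> block_of K s"
    using *[of "cell_index K (fst s)" "cell_index K (snd s)"] cell_index_less[of K] ij(1)
    unfolding block_of_def by simp
  moreover have "s \<in> B \<Longrightarrow> B = block_of K s"
    using *[OF ij(1,2)] ij(3) by (simp add: block_of_def)
  ultimately show ?thesis by blast
qed

lemma block_eq_block_of: "B \<in> blocks K \<Longrightarrow> s \<in> B \<Longrightarrow> B = block_of K s"
  using block_subset mem_block_iff by blast

lemma blocks_eqI:
  assumes "B \<in> blocks K" "B' \<in> blocks K" "s \<in> B" "s \<in> B'"
  shows "B = B'"
  using block_eq_block_of[OF assms(1,3)] block_eq_block_of[OF assms(2,4)] by (rule trans[OF _ sym])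

lemma corner_in_block: "i < K \<Longrightarrow> j < K \<Longrightarrow> (real i / real K, real j / real K) \<in> block K i j"
  by (simp add: block_def left_end_in_cell)

lemma block_nonempty: "B \<in> blocks K \<Longrightarrow> B \<noteq> {}"
  using corner_in_block by (auto simp: blocks_def)

lemma blocks_eq_image: "blocks K = (\<lambda>(i, j). block K i j) ` ({..<K} \<times> {..<K})"
  by (auto simp: blocks_def)

lemma finite_blocks: "finite (blocks K)"
  by (simp add: blocks_eq_image)

text \<open>A block contains its lower left corner, and the cell indices of that corner recover
  \<open>i\<close> and \<open>j\<close>.\<close>

lemma inj_on_block: "inj_on (\<lambda>(i, j). block K i j) ({..<K} \<times> {..<K})"
proof (rule inj_onI, clarsimp)
  fix i j i' j' assume ij: "i < K" "j < K" "i' < K" "j' < K" "block K i j = block K i' j'"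
  have "real i / real K \<in> cell K i'" "real j / real K \<in> cell K j'"
    using corner_in_block[OF ij(1,2)] ij(5) by (auto simp: block_def)
  moreover have "real i / real K \<in> cell K i" "real j / real K \<in> cell K j"
    using ij by (auto intro: left_end_in_cell)
  moreover have "0 \<le> real i / real K" "real i / real K \<le> 1" "0 \<le> real j / real K" "real j / real K \<le> 1"
    using ij by (auto simp: divide_simps)
  ultimately show "i = i' \<and> j = j'"
    using mem_cell_iff[OF ij(1), of "real i / real K"] mem_cell_iff[OF ij(3), of "real i / real K"]
      mem_cell_iff[OF ij(2), of "real j / real K"] mem_cell_iff[OF ij(4), of "real j / real K"]
    by simp
qed

lemma card_blocks: "card (blocks K) = K\<^sup>2"
  by (simp add: blocks_eq_image card_image[OF inj_on_block] power2_eq_square)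

text \<open>Adding the two coordinate differences gives 2 in place of the sharp constant
  \<open>sqrt 2\<close>, which keeps the later radii at integer multiples of
  \<open>1 / K\<close>.\<close>

lemma block_diameter:
  assumes "B \<in> blocks K" "s \<in> B" "t \<in> B"
  shows "dist s t \<le> 2 / real K"
proof -
  obtain i j where ij: "i < K" "j < K" "B = block K i j"
    using assms by (auto simp: blocks_def)
  have "dist (fst s) (fst t) \<le> 1 / real K" "dist (snd s) (snd t) \<le> 1 / real K"
    using assms ij by (auto simp: block_def dist_real_def intro: cell_diameter)
  moreover have "dist s t \<le> dist (fst s) (fst t) + dist (snd s) (snd t)"
    unfolding dist_prod_def by (rule sqrt_sum_squares_le_sum) auto
  ultimately show ?thesis by simp
qed

lemma grid_edges_subset: "e \<in> grid_edges K \<Longrightarrow> e \<subseteq> blocks K"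
  by (auto simp: grid_edges_def blocks_def)

lemma finite_grid_edges: "finite (grid_edges K)"
  using finite_subset[of "grid_edges K" "Pow (blocks K)"] grid_edges_subset finite_blocks by auto

section \<open>Grid walks that follow connected planar sets\<close>

lemma cell_index_close:
  assumes "K > 0" "\<bar>x - y\<bar> < 1 / real K"
  shows "\<bar>int (cell_index K x) - int (cell_index K y)\<bar> \<le> 1"
proof -
  have "\<bar>x * real K - y * real K\<bar> < 1"
    using assms by (simp add: left_diff_distrib[symmetric] abs_mult divide_simps)
  then have "\<bar>\<lfloor>x * real K\<rfloor> - \<lfloor>y * real K\<rfloor>\<bar> \<le> 1"
    by linarith
  then show ?thesis
    using assms(1) unfolding cell_index_def by linarith
qed

text \<open>The two blocks may be diagonal neighbours, which the grid does not join. The walk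
  therefore turns at the block of the point with the first coordinate of \<open>t\<close> and the
  second of \<open>s\<close>. That point is also within \<open>1 / K\<close> of \<open>s\<close>, so
  \<open>Q\<close> contains its block.\<close>

lemma reach_grid_close:
  assumes K: "K > 0" and s: "s \<in> {0..1} \<times> {0..1}" and t: "t \<in> {0..1} \<times> {0..1}"
    and d: "dist s t < 1 / real K"
    and Q: "\<And>B. B \<in> blocks K \<Longrightarrow> B \<inter> ball s (1 / real K) \<noteq> {} \<Longrightarrow> B \<in> Q"
  shows "reach {e \<in> grid_edges K. e \<subseteq> Q} (block_of K s) (block_of K t)"
proof -
  obtain a b where ab: "s = (a, b)" by (cases s)
  obtain a' b' where ab': "t = (a', b')" by (cases t)
  let ?u = "(a', b)"
  have d1: "\<bar>a - a'\<bar> < 1 / real K" "\<bar>b - b'\<bar> < 1 / real K"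
    using d dist_fst_le[of s t] dist_snd_le[of s t] by (auto simp: ab ab' dist_real_def)
  have inQ: "block_of K r \<in> Q" if "r \<in> {0..1} \<times> {0..1}" "dist s r < 1 / real K" for r
  proof (rule Q)
    show B: "block_of K r \<in> blocks K" by (rule block_of_in_blocks[OF K])
    have "r \<in> block_of K r" using mem_block_iff[OF B that(1)] by simp
    then show "block_of K r \<inter> ball s (1 / real K) \<noteq> {}" using that(2) by auto
  qed
  have "dist s ?u < 1 / real K"
    using d1 by (simp add: ab dist_prod_def dist_real_def)
  then have Qs: "block_of K s \<in> Q" "block_of K ?u \<in> Q" "block_of K t \<in> Q"
    using s t d K by (auto intro!: inQ simp: ab ab')
  let ?E = "{e \<in> grid_edges K. e \<subseteq> Q}"
  note less = cell_index_less[OF K]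
  have "reach ?E (block_of K s) (block_of K ?u)"
  proof (cases "cell_index K a = cell_index K a'")
    case True
    then show ?thesis by (simp add: ab block_of_def)
  next
    case False
    then have "\<bar>int (cell_index K a) - int (cell_index K a')\<bar> = 1"
      using cell_index_close[OF K d1(1)] by linarith
    then have "{block_of K s, block_of K ?u} \<in> grid_edges K"
      unfolding grid_edges_def block_of_def ab using less by force
    with Qs show ?thesis by (auto intro: reach_edge)
  qed
  moreover have "reach ?E (block_of K ?u) (block_of K t)"
  proof (cases "cell_index K b = cell_index K b'")
    case True
    then show ?thesis by (simp add: ab' block_of_def)
  next
    case False
    then have "\<bar>int (cell_index K b) - int (cell_index K b')\<bar> = 1"
      using cell_index_close[OF K d1(2)] by linarith
    then have "{block_of K ?u, block_of K t} \<in> grid_edges K"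
      unfolding grid_edges_def block_of_def ab' using less by force
    with Qs show ?thesis by (auto intro: reach_edge)
  qed
  ultimately show ?thesis by (rule reach_trans)
qed

text \<open>Having blocks joined by a walk in \<open>Q\<close> is an equivalence relation on the
  points of \<open>S\<close>, and it relates each point to all sufficiently near ones. A connected
  set then has a single class, so no subdivision of a path has to be chosen.\<close>

lemma reach_grid_connected:
  assumes K: "K > 0" and S: "connected S" "S \<subseteq> {0..1} \<times> {0..1}" "s \<in> S" "t \<in> S"
    and Q: "\<And>B r. B \<in> blocks K \<Longrightarrow> r \<in> S \<Longrightarrow> B \<inter> ball r (1 / real K) \<noteq> {} \<Longrightarrow> B \<in> Q"
  shows "reach {e \<in> grid_edges K. e \<subseteq> Q} (block_of K s) (block_of K t)"
proof (rule connected_equivalence_relation[OF S(1,3,4),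
    where R = "\<lambda>s t. reach {e \<in> grid_edges K. e \<subseteq> Q} (block_of K s) (block_of K t)"])
  fix a assume a: "a \<in> S"
  show "\<exists>T. openin (top_of_set S) T \<and> a \<in> T \<and>
    (\<forall>x\<in>T. reach {e \<in> grid_edges K. e \<subseteq> Q} (block_of K a) (block_of K x))"
  proof (intro exI[of _ "S \<inter> ball a (1 / real K)"] conjI ballI)
    fix x assume x: "x \<in> S \<inter> ball a (1 / real K)"
    show "reach {e \<in> grid_edges K. e \<subseteq> Q} (block_of K a) (block_of K x)"
    proof (rule reach_grid_close[OF K])
      show "a \<in> {0..1} \<times> {0..1}" "x \<in> {0..1} \<times> {0..1}" "dist a x < 1 / real K"
        using a x S(2) by auto
    qed (rule Q[OF _ a])
  qed (use a K in auto)
qed (erule reach_sym, erule (1) reach_trans)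

lemma connected_graph_grid:
  assumes "K > 0"
  shows "connected_graph (blocks K) (grid_edges K)"
  unfolding connected_graph_def
proof (intro conjI ballI)
  show "blocks K \<noteq> {}" using block_of_in_blocks[OF assms] by blast
  fix u v assume uv: "u \<in> blocks K" "v \<in> blocks K"
  then obtain s t where st: "s \<in> u" "t \<in> v" using block_nonempty by blast
  let ?S = "{0..1::real} \<times> {0..1::real}"
  have S: "s \<in> ?S" "t \<in> ?S" using st uv block_subset by blast+
  have "connected ?S" by (intro convex_connected convex_Times) auto
  then have "reach {e \<in> grid_edges K. e \<subseteq> blocks K} (block_of K s) (block_of K t)"
    by (rule reach_grid_connected[OF assms _ order_refl S]) auto
  moreover have "u = block_of K s" "v = block_of K t"
    using block_eq_block_of uv st by blast+
  ultimately have "reach {e \<in> grid_edges K. e \<subseteq> blocks K} u v" by simp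
  then show "reach (grid_edges K) u v" by (rule reach_mono) auto
qed

section \<open>Deep points and covering\<close>

text \<open>A compact set is totally bounded, so the set of sizes under \<open>LEAST\<close> is
  nonempty and the minimum is attained.\<close>

lemma covering_number_cover:
  assumes "compact S" "\<delta> > 0"
  obtains C where "finite C" "card C = covering_number S \<delta>" "S \<subseteq> (\<Union>x\<in>C. cball x \<delta>)"
proof -
  have "\<exists>k. finite k \<and> S \<subseteq> (\<Union>x\<in>k. ball x \<delta>)"
    using assms unfolding compact_eq_totally_bounded by simp
  then obtain k where k: "finite k" "S \<subseteq> (\<Union>x\<in>k. ball x \<delta>)" by (elim exE conjE)
  have "(\<Union>x\<in>k. ball x \<delta>) \<subseteq> (\<Union>x\<in>k. cball x \<delta>)"
    by (intro UN_mono order_refl ball_subset_cball)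
  with k(2) have "S \<subseteq> (\<Union>x\<in>k. cball x \<delta>)" by (rule order_trans)
  with k(1) have "\<exists>N C. finite C \<and> card C = N \<and> S \<subseteq> (\<Union>x\<in>C. cball x \<delta>)" by blast
  from LeastI_ex[OF this, folded covering_number_def]
  obtain C where "finite C \<and> card C = covering_number S \<delta> \<and> S \<subseteq> (\<Union>x\<in>C. cball x \<delta>)" ..
  then show ?thesis by (intro that[of C]) simp_all
qed

text \<open>A nearest point of \<open>S\<close> lies in one of the balls; the triangle inequality
  gives the rest. For empty \<open>S\<close> the value of \<open>infdist\<close> is 0 by convention
  and there would be no nearest point.\<close>

lemma near_cover_centre:
  fixes S :: "'a::heine_borel set"
  assumes "compact S" "S \<noteq> {}" "infdist s S < r" "S \<subseteq> (\<Union>x\<in>C. cball x \<delta>)"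
  shows "\<exists>x\<in>C. dist x s \<le> \<delta> + r"
proof -
  obtain f where f: "f \<in> S" "infdist s S = dist s f"
    using infdist_attains_inf[OF compact_imp_closed[OF assms(1)] assms(2), of s] by metis
  then have "f \<in> (\<Union>x\<in>C. cball x \<delta>)" using assms(4) by blast
  then obtain x where x: "x \<in> C" "dist x f \<le> \<delta>" by auto
  have "dist x s \<le> dist x f + dist s f" by (rule dist_triangle2)
  with x(2) f(2) assms(3) have "dist x s \<le> \<delta> + r" by linarith
  with x(1) show ?thesis by blast
qed

lemma card_nat_near:
  "finite {i::nat. \<bar>real i - t\<bar> \<le> 4}" "card {i::nat. \<bar>real i - t\<bar> \<le> 4} \<le> 9"
proof -
  let ?A = "{i::nat. \<bar>real i - t\<bar> \<le> 4}"
  have sub: "int ` ?A \<subseteq> {\<lceil>t - 4\<rceil>..\<lfloor>t + 4\<rfloor>}"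
    by clarsimp linarith
  then have "finite (int ` ?A)" by (rule finite_subset) simp
  then show "finite ?A" by (rule finite_imageD) simp
  have "card ?A = card (int ` ?A)" by (simp add: card_image)
  also have "\<dots> \<le> card {\<lceil>t - 4\<rceil>..\<lfloor>t + 4\<rfloor>}" by (rule card_mono[OF _ sub]) simp
  also have "\<dots> \<le> 9" by simp linarith
  finally show "card ?A \<le> 9" .
qed

text \<open>A block is tested at its lower left corner. The radius is the sum of the covering radius
  \<open>1 / K\<close> and the depth \<open>3 / K\<close>. The indices run over all naturals, which
  is enough for an upper count.\<close>

definition blocks_near :: "nat \<Rightarrow> real \<times> real \<Rightarrow> (real \<times> real) set set" where
  "blocks_near K x = {block K i j | i j. dist x (real i / real K, real j / real K) \<le> 4 / real K}"

text \<open>In each coordinate at most 9 integers lie in a closed interval of length 8, hence the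
  bound 81 = 9 * 9.\<close>

lemma card_blocks_near:
  assumes "K > 0"
  shows "finite (blocks_near K x) \<and> card (blocks_near K x) \<le> 81"
proof -
  define N where "N t = {i::nat. \<bar>real i - t * real K\<bar> \<le> 4}" for t
  have N: "finite (N t)" "card (N t) \<le> 9" for t
    using card_nat_near[of "t * real K"] by (simp_all add: N_def)
  have near: "i \<in> N a" if "dist a (real i / real K) \<le> 4 / real K" for a i
  proof -
    have "\<bar>real i / real K - a\<bar> * real K \<le> 4"
      using that assms by (simp add: dist_real_def pos_le_divide_eq abs_minus_commute)
    also have "\<bar>real i / real K - a\<bar> * real K = \<bar>(real i / real K - a) * real K\<bar>"
      by (simp add: abs_mult)
    finally show ?thesis
      using assms by (simp add: N_def left_diff_distrib)
  qed
  have "blocks_near K x \<subseteq> (\<lambda>(i, j). block K i j) ` (N (fst x) \<times> N (snd x))"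
  proof
    fix B assume "B \<in> blocks_near K x"
    then obtain i j where ij: "B = block K i j" "dist x (real i / real K, real j / real K) \<le> 4 / real K"
      unfolding blocks_near_def by blast
    have "i \<in> N (fst x)" "j \<in> N (snd x)"
      using dist_fst_le[of x "(real i / real K, real j / real K)"]
        dist_snd_le[of x "(real i / real K, real j / real K)"] ij(2)
      by (intro near, simp)+
    then show "B \<in> (\<lambda>(i, j). block K i j) ` (N (fst x) \<times> N (snd x))"
      using ij(1) by blast
  qed
  moreover have fin: "finite (N (fst x) \<times> N (snd x))" using N by simp
  ultimately have "finite (blocks_near K x)" "card (blocks_near K x) \<le> card (N (fst x) \<times> N (snd x))"
    by (rule finite_subset[OF _ finite_imageI], rule surj_card_le[rotated])
  moreover have "card (N (fst x) \<times> N (snd x)) \<le> 9 * 9"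
    unfolding card_cartesian_product by (rule mult_le_mono) (rule N)+
  ultimately show ?thesis by linarith
qed

text \<open>Each disc is enclosed in a square of side \<open>2 * r\<close>, and areas are
  subadditive.\<close>

lemma measure_le_cover:
  fixes A :: "(real \<times> real) set"
  assumes "A \<in> sets lebesgue" "finite C" "A \<subseteq> (\<Union>x\<in>C. cball x r)" "r \<ge> 0"
  shows "measure lebesgue A \<le> real (card C) * (2 * r)\<^sup>2"
proof -
  have ball: "measure lebesgue (cball x r) \<le> (2 * r)\<^sup>2" for x :: "real \<times> real"
  proof -
    obtain a b where x: "x = (a, b)" by (cases x)
    have "cball x r \<subseteq> cbox (a - r, b - r) (a + r, b + r)"
    proof
      fix y assume y: "y \<in> cball x r"
      have "dist a (fst y) \<le> r" "dist b (snd y) \<le> r"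
        using y dist_fst_le[of x y] dist_snd_le[of x y] by (auto simp: x)
      then show "y \<in> cbox (a - r, b - r) (a + r, b + r)"
        by (cases y) (auto simp: cbox_Pair_eq dist_real_def)
    qed
    then have "measure lebesgue (cball x r) \<le> measure lebesgue (cbox (a - r, b - r) (a + r, b + r))"
      by (intro measure_mono_fmeasurable) auto
    also have "\<dots> = (2 * r) * (2 * r)"
      using assms(4) by (simp add: content_Pair)
    finally show ?thesis by (simp add: power2_eq_square)
  qed
  have "measure lebesgue A \<le> measure lebesgue (\<Union>x\<in>C. cball x r)"
    by (rule measure_mono_fmeasurable[OF assms(3,1)]) (simp add: assms(2) fmeasurable.finite_UN)
  also have "\<dots> \<le> (\<Sum>x\<in>C. measure lebesgue (cball x r))"
    by (rule measure_UNION_le[OF assms(2)]) simp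
  also have "\<dots> \<le> (\<Sum>x\<in>C. (2 * r)\<^sup>2)" by (rule sum_mono) (rule ball)
  finally show ?thesis by simp
qed

text \<open>A ball that meets \<open>S\<close> but not its frontier lies in \<open>S\<close>, since
  it is connected. The depth 3 is 1 for the distance to the block plus 2 for the diameter of the
  block.\<close>

lemma block_subset_of_deep:
  assumes "s \<in> S" "3 / real K \<le> infdist s (frontier S)" "B \<in> blocks K" "B \<inter> ball s (1 / real K) \<noteq> {}"
  shows "B \<subseteq> S"
proof -
  have "f \<notin> ball s (3 / real K)" if "f \<in> frontier S" for f
    using assms(2) infdist_le[OF that, of s] by simp
  then have "ball s (3 / real K) \<inter> frontier S = {}" by blast
  moreover obtain t where t: "t \<in> B" "dist s t < 1 / real K" using assms(4) by auto
  then have "1 / real K > 0" using zero_le_dist[of s t] by linarith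
  then have "s \<in> ball s (3 / real K)" by (simp add: zero_less_divide_iff)
  then have "ball s (3 / real K) \<inter> S \<noteq> {}" using assms(1) by blast
  ultimately have "ball s (3 / real K) - S = {}"
    using connected_Int_frontier[OF connected_ball, of s "3 / real K" S] by metis
  then have "ball s (3 / real K) \<subseteq> S" by blast
  moreover have "B \<subseteq> ball s (3 / real K)"
  proof
    fix r assume "r \<in> B"
    then have "dist t r \<le> 2 / real K" using block_diameter[OF assms(3) t(1)] by simp
    moreover have "3 / real K = 1 / real K + 2 / real K" by (simp add: add_divide_distrib[symmetric])
    ultimately show "r \<in> ball s (3 / real K)"
      using t(2) dist_triangle[of s r t] by auto
  qed
  ultimately show ?thesis by blast
qed

text \<open>The seed \<open>H\<close> is the grid component of one deep block among the blocks
  included in \<open>S\<close>. The path from \<open>s0\<close> to another deep point stays deep, so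
  all blocks close to it are included in \<open>S\<close> and the walk along it does not leave the
  component.\<close>

lemma deep_blocks_connected:
  assumes K: "K > 0" and S: "S \<subseteq> {0..1} \<times> {0..1}"
    and path: "\<And>s t. s \<in> S \<Longrightarrow> t \<in> S \<Longrightarrow>
       \<exists>p. path p \<and> path_image p \<subseteq> S \<and> pathstart p = s \<and> pathfinish p = t \<and>
         (setdist (path_image p) (frontier S) = min (infdist s (frontier S)) (infdist t (frontier S))
          \<or> setdist (path_image p) (frontier S) \<ge> C')"
    and C': "3 / real K \<le> C'"
    and s0: "s0 \<in> S" "3 / real K \<le> infdist s0 (frontier S)"
  obtains H where "H \<noteq> {}" "H \<subseteq> blocks K" "connected_in (grid_edges K) H" "\<And>B. B \<in> H \<Longrightarrow> B \<subseteq> S"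
    "\<And>s. s \<in> S \<Longrightarrow> 3 / real K \<le> infdist s (frontier S) \<Longrightarrow> block_of K s \<in> H"
proof -
  define Q where "Q = {B \<in> blocks K. B \<subseteq> S}"
  define E where "E = {e \<in> grid_edges K. e \<subseteq> Q}"
  define H where "H = {B. reach E (block_of K s0) B}"
  have deep: "block_of K s \<in> H" if s: "s \<in> S" "3 / real K \<le> infdist s (frontier S)" for s
  proof -
    obtain p where p: "path p" "path_image p \<subseteq> S" "pathstart p = s0" "pathfinish p = s"
      and "setdist (path_image p) (frontier S) = min (infdist s0 (frontier S)) (infdist s (frontier S))
          \<or> setdist (path_image p) (frontier S) \<ge> C'"
      using path[OF s0(1) s(1)] by (elim exE conjE, intro that)
    \<comment> \<open>Either alternative suffices: both end points are deep, and \<open>C'\<close>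
      is at least the depth.\<close>
    from this(5) have sd: "3 / real K \<le> setdist (path_image p) (frontier S)"
      using s0(2) s(2) C' by linarith
    have "reach E (block_of K s0) (block_of K s)"
      unfolding E_def
    proof (rule reach_grid_connected[OF K])
      show "connected (path_image p)" using p(1) by (rule connected_path_image)
      show "path_image p \<subseteq> {0..1} \<times> {0..1}" using p(2) S by blast
      show "s0 \<in> path_image p" "s \<in> path_image p"
        using pathstart_in_path_image[of p] pathfinish_in_path_image[of p] p(3,4) by simp_all
    next
      fix B r assume B: "B \<in> blocks K" "r \<in> path_image p" "B \<inter> ball r (1 / real K) \<noteq> {}"
      have "setdist (path_image p) (frontier S) \<le> setdist {r} (frontier S)"
        by (rule setdist_subset_left) (use B in auto)
      with sd have "3 / real K \<le> infdist r (frontier S)"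
        by (simp add: infdist_eq_setdist)
      then have "B \<subseteq> S" using B p(2) by (intro block_subset_of_deep[of r S K B]) auto
      with B show "B \<in> Q" by (simp add: Q_def)
    qed
    then show ?thesis by (simp add: H_def)
  qed
  \<comment> \<open>As \<open>reach\<close> is reflexive, the starting block belongs to
    \<open>H\<close> whatever the edges are, so its inclusion in \<open>S\<close> is checked
    separately.\<close>
  have s0B: "block_of K s0 \<in> Q"
  proof -
    have "s0 \<in> block_of K s0"
      using mem_block_iff[OF block_of_in_blocks[OF K], of s0 s0] s0(1) S by blast
    then have "block_of K s0 \<inter> ball s0 (1 / real K) \<noteq> {}" using K by auto
    then show ?thesis
      using block_subset_of_deep[OF s0 block_of_in_blocks[OF K]] block_of_in_blocks[OF K] by (simp add: Q_def)
  qed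
  have HQ: "H \<subseteq> Q"
  proof
    fix B assume "B \<in> H"
    then have "reach E (block_of K s0) B" by (simp add: H_def)
    then show "B \<in> Q" by (rule reach_closed[OF _ s0B]) (auto simp: E_def)
  qed
  show ?thesis
  proof (rule that)
    show "H \<noteq> {}" using deep[OF s0] by blast
    show "H \<subseteq> blocks K" using HQ by (auto simp: Q_def)
    show "connected_in (grid_edges K) H"
      unfolding H_def by (rule connected_in_mono[OF connected_in_component]) (auto simp: E_def)
    show "B \<subseteq> S" if "B \<in> H" for B using that HQ by (auto simp: Q_def)
  qed (rule deep)
qed

text \<open>A seed block stays in the cluster of its seed, so it cannot be misplaced if it lies in
  the matching \<open>D i\<close>. Seeds need not lie in \<open>D i\<close>; the bound discounts
  only the blocks that do, so the result serves both grid regimes. Misplaced blocks belong to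
  disjoint clusters, which turns the cardinality of the union into a sum.\<close>

lemma model_space_extension:
  fixes I :: "'i set"
  assumes K: "K > 0" and I: "finite I" "I \<noteq> {}"
    and H: "\<And>i. i \<in> I \<Longrightarrow> H i \<noteq> {} \<and> H i \<subseteq> blocks K \<and> connected_in (grid_edges K) (H i)"
    and disj: "disjoint_family_on H I"
  shows "\<exists>Dstar. inj_on Dstar I \<and> Dstar ` I \<in> model_space K \<and>
    card (\<Union>i\<in>I. misplaced K (Dstar i) (D i)) = (\<Sum>i\<in>I. card (misplaced K (Dstar i) (D i))) \<and>
    (\<Sum>i\<in>I. card (misplaced K (Dstar i) (D i))) \<le> card (blocks K - (\<Union>i\<in>I. {B \<in> H i. B \<subseteq> D i}))"
proof -
  obtain P where P: "\<forall>i\<in>I. H i \<subseteq> P i \<and> connected_in (grid_edges K) (P i)"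
    and dP: "disjoint_family_on P I" and UP: "(\<Union>i\<in>I. P i) = blocks K"
    using connected_partition_extension[OF finite_blocks connected_graph_grid[OF K] grid_edges_subset I(2) H disj]
    by blast
  have ne: "P i \<noteq> {}" if "i \<in> I" for i using P H[OF that] that by blast
  obtain T F where TF: "is_spanning_tree (blocks K) (grid_edges K) T" "F \<subseteq> T"
      "graph_components (blocks K) (T - F) = P ` I"
    using spanning_tree_of_connected_partition[OF finite_grid_edges connected_graph_grid[OF K] _ ne dP UP] P
    by metis
  define Dstar where "Dstar i = \<Union> (P i)" for i
  have PB: "P i \<subseteq> blocks K" if "i \<in> I" for i using UP that by blast
  \<comment> \<open>Blocks are nonempty and pairwise disjoint, so a block covered by a union of
    blocks is one of them.\<close>
  have memP: "B \<in> P i" if i: "i \<in> I" and B: "B \<in> blocks K" "B \<subseteq> Dstar i" for i B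
  proof -
    obtain s where s: "s \<in> B" using block_nonempty[OF B(1)] by blast
    then obtain B' where B': "B' \<in> P i" "s \<in> B'" using B by (auto simp: Dstar_def)
    then have "B = B'" using blocks_eqI[of B K B' s] B(1) s PB[OF i] by blast
    with B' show ?thesis by simp
  qed
  have "inj_on Dstar I"
  proof (rule inj_onI)
    fix i j assume ij: "i \<in> I" "j \<in> I" "Dstar i = Dstar j"
    obtain B where B: "B \<in> P i" using ne[OF ij(1)] by blast
    then have "B \<subseteq> Dstar j" using ij(3) by (auto simp: Dstar_def)
    then have "B \<in> P j" using memP ij(1,2) B PB by blast
    then show "i = j" using dP ij(1,2) B by (auto simp: disjoint_family_on_def)
  qed
  moreover have "Dstar ` I = \<Union> ` graph_components (blocks K) (T - F)"
    unfolding TF(3) by (simp add: image_image Dstar_def)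
  then have "Dstar ` I \<in> model_space K"
    unfolding model_space_def using TF(1,2) by blast
  moreover have misP: "misplaced K (Dstar i) (D i) \<subseteq> P i" if "i \<in> I" for i
    using memP[OF that] by (auto simp: misplaced_def)
  then have card: "card (\<Union>i\<in>I. misplaced K (Dstar i) (D i)) = (\<Sum>i\<in>I. card (misplaced K (Dstar i) (D i)))"
  proof (intro card_UN_disjoint I ballI impI)
    fix i assume "i \<in> I"
    show "finite (misplaced K (Dstar i) (D i))"
      by (rule finite_subset[OF _ finite_blocks[of K]]) (auto simp: misplaced_def)
  next
    fix i j assume ij: "i \<in> I" "j \<in> I" "i \<noteq> j"
    then have "P i \<inter> P j = {}" using dP by (simp add: disjoint_family_on_def)
    then show "misplaced K (Dstar i) (D i) \<inter> misplaced K (Dstar j) (D j) = {}"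
      using misP ij by blast
  qed
  moreover have "(\<Union>i\<in>I. misplaced K (Dstar i) (D i)) \<subseteq> blocks K - (\<Union>i\<in>I. {B \<in> H i. B \<subseteq> D i})"
  proof
    fix B assume "B \<in> (\<Union>i\<in>I. misplaced K (Dstar i) (D i))"
    then obtain i where i: "i \<in> I" "B \<in> misplaced K (Dstar i) (D i)" by blast
    have "B \<in> blocks K" "\<not> B \<subseteq> D i" using i(2) by (auto simp: misplaced_def)
    moreover have "j = i" if "j \<in> I" "B \<in> H j" for j
    proof (rule ccontr)
      assume "j \<noteq> i"
      then have "P j \<inter> P i = {}" using dP i that by (simp add: disjoint_family_on_def)
      then show False using P that misP[OF i(1)] i(2) by blast
    qed
    ultimately show "B \<in> blocks K - (\<Union>i\<in>I. {B \<in> H i. B \<subseteq> D i})" by blast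
  qed
  then have "card (\<Union>i\<in>I. misplaced K (Dstar i) (D i)) \<le> card (blocks K - (\<Union>i\<in>I. {B \<in> H i. B \<subseteq> D i}))"
    by (rule card_mono[OF finite_Diff[OF finite_blocks]])
  ultimately show ?thesis by (intro exI[of _ Dstar]) simp
qed

section \<open>Coarse and fine grids\<close>

text \<open>Distinct single blocks serve as seeds; the bound is the total number of blocks.\<close>

lemma crude_model_partition:
  assumes K: "K > 0" and I: "finite I" "I \<noteq> {}" "card I \<le> K\<^sup>2"
  shows "\<exists>Dstar. inj_on Dstar I \<and> Dstar ` I \<in> model_space K \<and>
    card (\<Union>i\<in>I. misplaced K (Dstar i) (D i)) = (\<Sum>i\<in>I. card (misplaced K (Dstar i) (D i))) \<and>
    (\<Sum>i\<in>I. card (misplaced K (Dstar i) (D i))) \<le> K\<^sup>2"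
proof -
  obtain f where f: "f ` I \<subseteq> blocks K" "inj_on f I"
    using card_le_inj[OF I(1) finite_blocks[of K]] I(3) unfolding card_blocks by blast
  have "{f i} \<noteq> {} \<and> {f i} \<subseteq> blocks K \<and> connected_in (grid_edges K) {f i}" if "i \<in> I" for i
    using f(1) that by (auto simp: connected_in_def)
  moreover have "disjoint_family_on (\<lambda>i. {f i}) I"
    using f(2) by (auto simp: disjoint_family_on_def inj_on_def)
  moreover have "card (blocks K - X) \<le> K\<^sup>2" for X
    using card_mono[OF finite_blocks, of "blocks K - X" K] by (simp add: card_blocks)
  ultimately show ?thesis
    using model_space_extension[OF K I(1,2), of "\<lambda>i. {f i}" D] by (meson order_trans)
qed

text \<open>Here \<open>M\<close> bounds the number of frontier balls per sub-domain. The area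
  hypothesis says that discs of radius \<open>4 / K\<close> about their centres, each enclosed in a
  square of side \<open>8 / K\<close>, cannot cover \<open>D l\<close>; this forces a deep
  point.\<close>

lemma fine_model_partition:
  fixes D :: "'i \<Rightarrow> (real \<times> real) set"
  assumes K: "K > 0" and I: "finite I" "I \<noteq> {}"
    and disj: "disjoint_family_on D I" and U: "(\<Union>l\<in>I. D l) = {0..1} \<times> {0..1}"
    and C': "3 / real K \<le> C'"
    and path: "\<And>l s t. l \<in> I \<Longrightarrow> s \<in> D l \<Longrightarrow> t \<in> D l \<Longrightarrow>
       \<exists>p. path p \<and> path_image p \<subseteq> D l \<and> pathstart p = s \<and> pathfinish p = t \<and>
         (setdist (path_image p) (frontier (D l)) = min (infdist s (frontier (D l))) (infdist t (frontier (D l)))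
          \<or> setdist (path_image p) (frontier (D l)) \<ge> C')"
    and cov: "\<And>l. l \<in> I \<Longrightarrow> real (covering_number (frontier (D l)) (1 / real K)) \<le> M"
    and area: "\<And>l. l \<in> I \<Longrightarrow> M * (8 / real K)\<^sup>2 < measure lebesgue (D l)"
  shows "\<exists>Dstar. inj_on Dstar I \<and> Dstar ` I \<in> model_space K \<and>
    card (\<Union>l\<in>I. misplaced K (Dstar l) (D l)) = (\<Sum>l\<in>I. card (misplaced K (Dstar l) (D l))) \<and>
    real (\<Sum>l\<in>I. card (misplaced K (Dstar l) (D l))) \<le> 81 * M * real (card I)"
proof -
  have sub: "D l \<subseteq> {0..1} \<times> {0..1}" if "l \<in> I" for l using U that by blast
  have "\<exists>C. finite C \<and> real (card C) \<le> M \<and>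
      (\<forall>s\<in>D l. infdist s (frontier (D l)) < 3 / real K \<longrightarrow> (\<exists>x\<in>C. dist x s \<le> 4 / real K))"
    if l: "l \<in> I" for l
  proof -
    have bnd: "bounded (D l)"
      by (rule bounded_subset[OF _ sub[OF l]]) (intro bounded_Times bounded_closed_interval)
    then have cpt: "compact (frontier (D l))" by (rule compact_frontier_bounded)
    obtain C where C: "finite C" "card C = covering_number (frontier (D l)) (1 / real K)"
        "frontier (D l) \<subseteq> (\<Union>x\<in>C. cball x (1 / real K))"
      using covering_number_cover[OF cpt, of "1 / real K"] K by auto
    have "\<exists>x\<in>C. dist x s \<le> 4 / real K" if s: "s \<in> D l" "infdist s (frontier (D l)) < 3 / real K" for s
    proof -
      \<comment> \<open>A nonempty bounded set is not the whole plane, so its frontier is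
        nonempty.\<close>
      have "D l \<noteq> UNIV" using bnd not_bounded_UNIV by metis
      with s(1) have "frontier (D l) \<noteq> {}" using frontier_not_empty[of "D l"] by blast
      moreover have "1 / real K + 3 / real K = 4 / real K" by (simp add: add_divide_distrib[symmetric])
      ultimately show ?thesis using near_cover_centre[OF cpt _ s(2) C(3)] by simp
    qed
    with C(1,2) cov[OF l] show ?thesis by (intro exI[of _ C]) simp
  qed
  then obtain C where C: "\<And>l. l \<in> I \<Longrightarrow> finite (C l)" "\<And>l. l \<in> I \<Longrightarrow> real (card (C l)) \<le> M"
    "\<And>l s. l \<in> I \<Longrightarrow> s \<in> D l \<Longrightarrow> infdist s (frontier (D l)) < 3 / real K \<Longrightarrow> \<exists>x\<in>C l. dist x s \<le> 4 / real K"
    by metis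
  have "\<exists>s0. s0 \<in> D l \<and> 3 / real K \<le> infdist s0 (frontier (D l))" if l: "l \<in> I" for l
  proof (rule ccontr)
    assume shallow: "\<not> ?thesis"
    have "D l \<subseteq> (\<Union>x\<in>C l. cball x (4 / real K))"
    proof
      fix s assume s: "s \<in> D l"
      then have "infdist s (frontier (D l)) < 3 / real K" using shallow by (metis not_le)
      then show "s \<in> (\<Union>x\<in>C l. cball x (4 / real K))" using C(3)[OF l s] by auto
    qed
    moreover have M: "0 \<le> M" using C(2)[OF l] by linarith
    then have "0 < measure lebesgue (D l)"
      by (intro le_less_trans[OF _ area[OF l]]) simp
    \<comment> \<open>The measure of a non-measurable set is 0 by convention, so positive area
      yields measurability.\<close>
    then have "D l \<in> sets lebesgue" using measure_notin_sets by force
    ultimately have "measure lebesgue (D l) \<le> real (card (C l)) * (2 * (4 / real K))\<^sup>2"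
      by (intro measure_le_cover C(1) l) auto
    also have "\<dots> \<le> M * (8 / real K)\<^sup>2"
      using mult_right_mono[OF C(2)[OF l], of "(8 / real K)\<^sup>2"] by simp
    finally show False using area[OF l] by simp
  qed
  then obtain s0 where s0: "\<And>l. l \<in> I \<Longrightarrow> s0 l \<in> D l"
      "\<And>l. l \<in> I \<Longrightarrow> 3 / real K \<le> infdist (s0 l) (frontier (D l))"
    by metis
  have "\<exists>H. H \<noteq> {} \<and> H \<subseteq> blocks K \<and> connected_in (grid_edges K) H \<and> (\<forall>B\<in>H. B \<subseteq> D l) \<and>
      (\<forall>s\<in>D l. 3 / real K \<le> infdist s (frontier (D l)) \<longrightarrow> block_of K s \<in> H)" if l: "l \<in> I" for l
    by (rule deep_blocks_connected[OF K sub[OF l] path[OF l] C' s0(1)[OF l] s0(2)[OF l]]) blast+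
  then obtain H where H: "\<And>l. l \<in> I \<Longrightarrow> H l \<noteq> {} \<and> H l \<subseteq> blocks K \<and> connected_in (grid_edges K) (H l)"
      "\<And>l B. l \<in> I \<Longrightarrow> B \<in> H l \<Longrightarrow> B \<subseteq> D l"
      "\<And>l s. l \<in> I \<Longrightarrow> s \<in> D l \<Longrightarrow> 3 / real K \<le> infdist s (frontier (D l)) \<Longrightarrow> block_of K s \<in> H l"
    by metis
  have dH: "disjoint_family_on H I"
    unfolding disjoint_family_on_def
  proof (intro ballI impI, rule ccontr)
    fix l m assume lm: "l \<in> I" "m \<in> I" "l \<noteq> m" "H l \<inter> H m \<noteq> {}"
    then obtain B where B: "B \<in> H l" "B \<in> H m" by blast
    obtain s where "s \<in> B" using block_nonempty[of B K] H(1)[OF lm(1)] B(1) by blast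
    then have "s \<in> D l \<inter> D m" using H(2)[OF lm(1) B(1)] H(2)[OF lm(2) B(2)] by blast
    then show False using disj lm(1-3) by (auto simp: disjoint_family_on_def)
  qed
  define W where "W = (\<Union>l\<in>I. \<Union>x\<in>C l. blocks_near K x)"
  \<comment> \<open>The lower left corner of a block lies in some \<open>D l\<close>. Were it deep
    there, the block would belong to the seed \<open>H l\<close>; so the corner is shallow and near
    a centre.\<close>
  have "blocks K - (\<Union>l\<in>I. {B \<in> H l. B \<subseteq> D l}) \<subseteq> W"
  proof
    fix B assume B: "B \<in> blocks K - (\<Union>l\<in>I. {B \<in> H l. B \<subseteq> D l})"
    then obtain i j where ij: "i < K" "j < K" "B = block K i j" unfolding blocks_def by blast
    define s where "s = (real i / real K, real j / real K)"
    have sB: "s \<in> B" unfolding ij(3) s_def by (rule corner_in_block[OF ij(1,2)])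
    then have "s \<in> (\<Union>l\<in>I. D l)" using block_subset[of B K] B U by blast
    then obtain l where l: "l \<in> I" "s \<in> D l" by blast
    have "block_of K s = B" using block_eq_block_of[of B K s] B sB by simp
    then have "infdist s (frontier (D l)) < 3 / real K"
      using H(3)[OF l] H(2)[OF l(1), of B] B l(1) by (cases "3 / real K \<le> infdist s (frontier (D l))") auto
    then obtain x where x: "x \<in> C l" "dist x s \<le> 4 / real K" using C(3)[OF l] by blast
    then have "B \<in> blocks_near K x" unfolding blocks_near_def ij(3) s_def by blast
    with l(1) x(1) show "B \<in> W" unfolding W_def by blast
  qed
  moreover have "finite W"
    unfolding W_def using I(1) C(1) card_blocks_near[OF K] by blast
  ultimately have "card (blocks K - (\<Union>l\<in>I. {B \<in> H l. B \<subseteq> D l})) \<le> card W"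
    by (rule card_mono[rotated])
  also have "\<dots> \<le> (\<Sum>l\<in>I. card (\<Union>x\<in>C l. blocks_near K x))"
    unfolding W_def by (rule card_UN_le[OF I(1)])
  also have "\<dots> \<le> (\<Sum>l\<in>I. 81 * card (C l))"
  proof (rule sum_mono)
    fix l assume l: "l \<in> I"
    have "card (\<Union>x\<in>C l. blocks_near K x) \<le> (\<Sum>x\<in>C l. card (blocks_near K x))"
      by (rule card_UN_le[OF C(1)[OF l]])
    also have "\<dots> \<le> (\<Sum>x\<in>C l. 81)"
      by (rule sum_mono) (use card_blocks_near[OF K] in blast)
    finally show "card (\<Union>x\<in>C l. blocks_near K x) \<le> 81 * card (C l)" by simp
  qed
  finally have "real (card (blocks K - (\<Union>l\<in>I. {B \<in> H l. B \<subseteq> D l}))) \<le> real (\<Sum>l\<in>I. 81 * card (C l))"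
    by (simp only: of_nat_le_iff)
  also have "\<dots> = (\<Sum>l\<in>I. 81 * real (card (C l)))" by simp
  also have "\<dots> \<le> (\<Sum>l\<in>I. 81 * M)" by (rule sum_mono) (use C(2) in simp)
  also have "\<dots> = 81 * M * real (card I)" by simp
  finally have bound: "real (card (blocks K - (\<Union>l\<in>I. {B \<in> H l. B \<subseteq> D l}))) \<le> 81 * M * real (card I)" .
  obtain Dstar where Ds: "inj_on Dstar I" "Dstar ` I \<in> model_space K"
      "card (\<Union>l\<in>I. misplaced K (Dstar l) (D l)) = (\<Sum>l\<in>I. card (misplaced K (Dstar l) (D l)))"
      "(\<Sum>l\<in>I. card (misplaced K (Dstar l) (D l))) \<le> card (blocks K - (\<Union>l\<in>I. {B \<in> H l. B \<subseteq> D l}))"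
    by (rule exE[OF model_space_extension[OF K I H(1) dH, of D]], assumption, elim conjE, intro that)
  from Ds(4) have "real (\<Sum>l\<in>I. card (misplaced K (Dstar l) (D l))) \<le>
      real (card (blocks K - (\<Union>l\<in>I. {B \<in> H l. B \<subseteq> D l})))"
    by (simp only: of_nat_le_iff)
  from this bound have "real (\<Sum>l\<in>I. card (misplaced K (Dstar l) (D l))) \<le> 81 * M * real (card I)"
    by (rule order_trans)
  with Ds(1-3) show ?thesis by blast
qed

text \<open>The bound \<open>k0 n \<le> (K n)\<^sup>2\<close> is forced by the conclusion:
  \<open>Dstar\<close> is injective and its values are unions of distinct components of a graph with
  \<open>(K n)\<^sup>2\<close> vertices. The constant \<open>c\<close> is chosen before
  \<open>n\<close>.\<close>

theorem proposition1:
  fixes K k0 :: "nat \<Rightarrow> nat"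
    and D :: "nat \<Rightarrow> nat \<Rightarrow> (real \<times> real) set"
    and c' C' :: real
  assumes "c' > 0" and "C' > 0"
    and "\<And>n. K n > 0"
    and "\<And>n. k0 n \<le> (K n)\<^sup>2"
    and "\<And>n. disjoint_family_on (D n) {1..k0 n}"
    and "\<And>n. (\<Union>l\<in>{1..k0 n}. D n l) = {0..1} \<times> {0..1}"
    and "\<And>n l. l \<in> {1..k0 n} \<Longrightarrow>
           c' / real (k0 n) \<le> measure lebesgue (D n l) \<and>
           measure lebesgue (D n l) \<le> C' / real (k0 n)"
    and "\<And>n l. l \<in> {1..k0 n} \<Longrightarrow> has_boundary_length (D n l)"
    and "\<And>n l. l \<in> {1..k0 n} \<Longrightarrow>
           c' \<le> boundary_length (D n l) / sqrt (measure lebesgue (D n l)) \<and>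
           boundary_length (D n l) / sqrt (measure lebesgue (D n l)) \<le> C'"
    and "\<And>n l \<delta>. l \<in> {1..k0 n} \<Longrightarrow> 0 < \<delta> \<Longrightarrow> \<delta> < boundary_length (D n l) \<Longrightarrow>
           real (covering_number (frontier (D n l)) \<delta>) \<le> C' * boundary_length (D n l) / \<delta>"
    and "\<And>n l s s'. l \<in> {1..k0 n} \<Longrightarrow> s \<in> D n l \<Longrightarrow> s' \<in> D n l \<Longrightarrow>
           \<exists>p. path p \<and> path_image p \<subseteq> D n l \<and> pathstart p = s \<and> pathfinish p = s' \<and>
             (setdist (path_image p) (frontier (D n l)) =
                min (infdist s (frontier (D n l))) (infdist s' (frontier (D n l)))
              \<or> setdist (path_image p) (frontier (D n l)) \<ge> C')"
  shows "\<exists>c>0. \<forall>n. \<exists>Dstar :: nat \<Rightarrow> (real \<times> real) set.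
           inj_on Dstar {1..k0 n} \<and>
           Dstar ` {1..k0 n} \<in> model_space (K n) \<and>
           card (\<Union>j\<in>{1..k0 n}. misplaced (K n) (Dstar j) (D n j)) =
             (\<Sum>j=1..k0 n. card (misplaced (K n) (Dstar j) (D n j))) \<and>
           real (\<Sum>j=1..k0 n. card (misplaced (K n) (Dstar j) (D n j)))
             \<le> c * sqrt (real (k0 n)) * real (K n)"
proof -
  \<comment> \<open>Threshold for the ratio of \<open>K\<close> to \<open>sqrt k0\<close>. Above it,
    the three terms ensure in turn that \<open>1 / K\<close> is less than every boundary length,
    that each area exceeds \<open>M * (8 / K)\<^sup>2\<close>, and that
    \<open>3 / K \<le> C'\<close>.\<close>
  define A where "A = 1 / (c' * sqrt c') + 64 * C'\<^sup>2 * sqrt C' / c' + 3 / C'"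
  have pos: "1 / (c' * sqrt c') > 0" "64 * C'\<^sup>2 * sqrt C' / c' > 0" "3 / C' > 0" "81 * C'\<^sup>2 * sqrt C' > 0"
    using assms(1,2) by simp_all
  then have A: "A > 0" "1 / (c' * sqrt c') \<le> A" "64 * C'\<^sup>2 * sqrt C' / c' \<le> A" "3 / C' \<le> A"
    unfolding A_def by linarith+
  define c where "c = A + 81 * C'\<^sup>2 * sqrt C'"
  have c: "c > 0" "A \<le> c" "81 * C'\<^sup>2 * sqrt C' \<le> c"
    using A(1) pos(4) unfolding c_def by linarith+
  have "\<exists>Dstar :: nat \<Rightarrow> (real \<times> real) set.
      inj_on Dstar {1..k0 n} \<and> Dstar ` {1..k0 n} \<in> model_space (K n) \<and>
      card (\<Union>j\<in>{1..k0 n}. misplaced (K n) (Dstar j) (D n j)) =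
        (\<Sum>j=1..k0 n. card (misplaced (K n) (Dstar j) (D n j))) \<and>
      real (\<Sum>j=1..k0 n. card (misplaced (K n) (Dstar j) (D n j))) \<le> c * sqrt (real (k0 n)) * real (K n)" for n
  proof -
    let ?I = "{1..k0 n}"
    define q where "q = sqrt (real (k0 n))"
    have K: "K n > 0" "real (K n) > 0" using assms(3)[of n] by simp_all
    have "k0 n \<noteq> 0"
    proof
      assume "k0 n = 0"
      then have "{0..1::real} \<times> {0..1::real} = {}" using assms(6)[of n] by simp
      then show False by simp
    qed
    then have I: "finite ?I" "?I \<noteq> {}" and k: "real (k0 n) \<ge> 1" by auto
    have q: "q \<ge> 1" "q\<^sup>2 = real (k0 n)" "q > 0"
      unfolding q_def using k by simp_all
    show ?thesis
    proof (cases "real (K n) \<le> A * q")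
      case True
      \<comment> \<open>On a coarse grid one factor \<open>K\<close> of the total number of blocks
        is absorbed by \<open>A * q\<close>.\<close>
      have "(real (K n))\<^sup>2 \<le> A * q * real (K n)"
        using mult_right_mono[OF True, of "real (K n)"] by (simp add: power2_eq_square)
      also have "\<dots> \<le> c * q * real (K n)"
        by (intro mult_right_mono c(2)) (use q K in simp_all)
      finally have bound: "real ((K n)\<^sup>2) \<le> c * q * real (K n)" by simp
      have kK: "card ?I \<le> (K n)\<^sup>2" using assms(4)[of n] by simp
      obtain Dstar where Ds: "inj_on Dstar ?I" "Dstar ` ?I \<in> model_space (K n)"
          "card (\<Union>j\<in>?I. misplaced (K n) (Dstar j) (D n j)) =
            (\<Sum>j=1..k0 n. card (misplaced (K n) (Dstar j) (D n j)))"
          "(\<Sum>j=1..k0 n. card (misplaced (K n) (Dstar j) (D n j))) \<le> (K n)\<^sup>2"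
        using crude_model_partition[OF K(1) I kK, of "D n"] by (elim exE conjE, intro that)
      have "real (\<Sum>j=1..k0 n. card (misplaced (K n) (Dstar j) (D n j))) \<le> real ((K n)\<^sup>2)"
        using Ds(4) by (simp only: of_nat_le_iff)
      from this bound have "real (\<Sum>j=1..k0 n. card (misplaced (K n) (Dstar j) (D n j))) \<le> c * q * real (K n)"
        by (rule order_trans)
      with Ds(1-3) show ?thesis unfolding q_def by blast
    next
      case False
      then have fine: "A * q < real (K n)" by simp
      have fineI: "r * q < real (K n)" if "r \<le> A" for r
        using mult_right_mono[OF that, of q] q fine by linarith
      \<comment> \<open>The covering hypothesis at \<open>\<delta> = 1 / K\<close> gives
        \<open>C' * b * K\<close> balls for boundary length \<open>b\<close>, where \<open>b\<close>
        is at most \<open>C'\<close> times the root of the area, and that root is at most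
        \<open>sqrt C' / q\<close>.\<close>
      define M where "M = C'\<^sup>2 * sqrt C' / q * real (K n)"
      have "3 / C' * 1 \<le> 3 / C' * q"
        by (rule mult_left_mono) (use q pos in simp_all)
      then have "3 / C' < real (K n)" using fineI[OF A(4)] by simp
      then have C': "3 / real (K n) \<le> C'"
        using K assms(2) by (simp add: field_simps)
      have areaM: "M * (8 / real (K n))\<^sup>2 < measure lebesgue (D n l)" if l: "l \<in> ?I" for l
      proof -
        have "64 * C'\<^sup>2 * sqrt C' / c' * q < real (K n)" by (rule fineI[OF A(3)])
        then have "64 * C'\<^sup>2 * sqrt C' * q < c' * real (K n)"
          using assms(1) by (simp add: field_simps)
        \<comment> \<open>Dividing by \<open>q\<^sup>2 * K\<close> turns the threshold into a
          comparison of \<open>M * (8 / K)\<^sup>2\<close> with the lower bound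
          \<open>c' / q\<^sup>2\<close> on the area.\<close>
        then have "64 * C'\<^sup>2 * sqrt C' * q / (q * (q * real (K n))) < c' * real (K n) / (q * (q * real (K n)))"
          using q(3) K by (intro divide_strict_right_mono) simp_all
        then have "64 * C'\<^sup>2 * sqrt C' / (q * real (K n)) < c' / q\<^sup>2"
          using q(3) K by (simp add: power2_eq_square mult.assoc)
        moreover have "M * (8 / real (K n))\<^sup>2 = 64 * C'\<^sup>2 * sqrt C' / (q * real (K n))"
          unfolding M_def using K q(3) by (simp add: field_simps power2_eq_square)
        ultimately show ?thesis
          using assms(7)[OF l] q(2) by simp
      qed
      have coverM: "real (covering_number (frontier (D n l)) (1 / real (K n))) \<le> M" if l: "l \<in> ?I" for l
      proof -
        let ?m = "measure lebesgue (D n l)" and ?b = "boundary_length (D n l)"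
        have m: "c' / q\<^sup>2 \<le> ?m" "?m \<le> C' / q\<^sup>2" using assms(7)[OF l] q(2) by simp_all
        have "0 < c' / q\<^sup>2" using assms(1) q(3) by simp
        then have m0: "0 < sqrt ?m" using m by simp
        have sm: "sqrt c' / q \<le> sqrt ?m" "sqrt ?m \<le> sqrt C' / q"
          using real_sqrt_le_mono[OF m(1)] real_sqrt_le_mono[OF m(2)] q(3) by (simp_all add: real_sqrt_divide)
        have b: "c' * sqrt ?m \<le> ?b" "?b \<le> C' * sqrt ?m"
          using assms(9)[OF l] m0 by (simp_all add: pos_le_divide_eq pos_divide_le_eq)
        have "1 / (c' * sqrt c') * q < real (K n)" by (rule fineI[OF A(2)])
        then have "1 / real (K n) < c' * (sqrt c' / q)"
          using assms(1) q(3) K by (simp add: field_simps)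
        also have "\<dots> \<le> c' * sqrt ?m" by (rule mult_left_mono[OF sm(1)]) (use assms(1) in simp)
        also have "\<dots> \<le> ?b" by (rule b(1))
        finally have "1 / real (K n) < ?b" .
        then have "real (covering_number (frontier (D n l)) (1 / real (K n))) \<le> C' * ?b / (1 / real (K n))"
          by (intro assms(10) l) (use K in simp_all)
        also have "\<dots> = C' * ?b * real (K n)" by simp
        also have "\<dots> \<le> C' * (C' * (sqrt C' / q)) * real (K n)"
          using order_trans[OF b(2) mult_left_mono[OF sm(2), of C']] assms(2) K
          by (intro mult_right_mono mult_left_mono) simp_all
        also have "\<dots> = M" unfolding M_def by (simp add: power2_eq_square)
        finally show ?thesis .
      qed
      obtain Dstar where Ds: "inj_on Dstar ?I" "Dstar ` ?I \<in> model_space (K n)"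
          "card (\<Union>j\<in>?I. misplaced (K n) (Dstar j) (D n j)) =
            (\<Sum>j=1..k0 n. card (misplaced (K n) (Dstar j) (D n j)))"
          "real (\<Sum>j=1..k0 n. card (misplaced (K n) (Dstar j) (D n j))) \<le> 81 * M * real (card ?I)"
        by (rule exE[OF fine_model_partition[OF K(1) I assms(5,6) C' assms(11) coverM areaM]],
          assumption+, elim conjE, intro that)
      \<comment> \<open>One factor \<open>q\<close> cancels the denominator of \<open>M\<close>; the
        other is the \<open>sqrt k0\<close> of the claim.\<close>
      have card_k: "real (card ?I) = q * q" using q(2) by (simp add: power2_eq_square)
      have "81 * M * real (card ?I) = 81 * C'\<^sup>2 * sqrt C' * q * real (K n)"
        unfolding M_def card_k using q(3) by simp
      also have "\<dots> \<le> c * q * real (K n)"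
        by (intro mult_right_mono c(3)) (use q K in simp_all)
      finally have bound: "81 * M * real (card ?I) \<le> c * q * real (K n)" .
      from Ds(4) bound have "real (\<Sum>j=1..k0 n. card (misplaced (K n) (Dstar j) (D n j))) \<le> c * q * real (K n)"
        by (rule order_trans)
      with Ds(1-3) show ?thesis unfolding q_def by blast
    qed
  qed
  with c(1) show ?thesis by blast
qed

end
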